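(* Let $\{V_j\}_{j\ge1}$ be a sequence of positive integers with $V_j=V_{j-1}+V_{j-2}$ for all $j\ge 3$, let $n\ge1$ be an integer and $d\ge 2$ an even integer, and assume $\gcd(V_1,V_2)=1$ and $\gcd(V_n,F_d)=1$. Let $S=\langle V_n,V_{n+d},V_{n+2d},\ldots\rangle$. Then the embedding dimension of $S$ is $\mathbf e(S)=\kappa$, where $\kappa$ is the smallest positive integer for which $F_{\kappa d}/F_d\ge V_n$.
   Context: $F_j$ denotes the $j$-th Fibonacci number ($F_0=0$, $F_1=F_2=1$, $F_j=F_{j-1}+F_{j-2}$). For a set $A$ of positive integers, $\langle A\rangle$ denotes the set of all finite linear combinations of elements of $A$ with non-negative integer coefficients; under the hypotheses, $S$ is a numerical semigroup (a submonoid of $\mathbb Z_{\ge0}$ with finite complement). The embedding dimension $\mathbf e(S)$ is the cardinality of the unique minimal generating set $S^\star\setminus(S^\star+S^\star)$ of $S$, where $S^\star=S\setminus\{0\}$. *)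

theory Defs
  imports Complex_Main "HOL-Library.Set_Algebras" "HOL-Number_Theory.Fib"
begin

text \<open>The empty combination is allowed, so \<open>0\<close> always belongs to the generated set.\<close>

definition semigroup_generated :: "nat set \<Rightarrow> nat set" where
  "semigroup_generated A = {\<Sum>a\<in>B. c a * a | B (c :: nat \<Rightarrow> nat). finite B \<and> B \<subseteq> A}"

text \<open>Below, \<open>+\<close> is the elementwise sum of sets and \<open>-\<close> is set difference.\<close>

definition minimal_generators :: "nat set \<Rightarrow> nat set" where
  "minimal_generators S = (let T = S - {0} in T - (T + T))"

text \<open>
  For a submonoid \<open>S\<close> of the natural numbers two distinct minimal generators are never congruent
  modulo a nonzero element of \<open>S\<close>, so \<open>minimal_generators S\<close> is finite and \<open>card\<close> is its true
  cardinality.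
\<close>

definition embedding_dimension :: "nat set \<Rightarrow> nat" where
  "embedding_dimension S = card (minimal_generators S)"

end

theory Submission
  imports Defs "HOL-Number_Theory.Cong"
begin

text \<open>
  Put \<open>x k = V (n + k d)\<close> and \<open>f k = F (k d) / F d\<close>. Since \<open>d\<close> is even, both satisfy
  \<open>y (k + 2) + y k = L y (k + 1)\<close> with \<open>L = F (d - 1) + F (d + 1)\<close>, whence
  \<open>x k = f (k - i) x (i + 1) - f (k - i - 1) x i\<close>.
  If \<open>f k \<ge> x 0\<close>, some \<open>i < k\<close> satisfies \<open>x i \<le> f (k - i)\<close> and \<open>x (i + 1) \<ge> f (k - i - 1)\<close>, and then
  \<open>x k = (x (i + 1) - f (k - i - 1)) x i + (f (k - i) - x i) x (i + 1)\<close> is decomposable.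
  If \<open>f k < x 0\<close>, suppose \<open>x k\<close> were a sum of smaller \<open>x i\<close>, and let \<open>N\<close> be the sum of the
  corresponding \<open>f i\<close>. Modulo \<open>x 0\<close> we have \<open>x i \<equiv> x 1 f i\<close>, so \<open>N \<equiv> f k\<close>; but \<open>x i / f i\<close> strictly
  decreases, so \<open>N < f k\<close>, which is impossible.
\<close>

section \<open>Generated semigroups and their minimal generators\<close>

lemma semigroup_generatedI:
  assumes "finite B" "B \<subseteq> A"
  shows "(\<Sum>a\<in>B. c a * a) \<in> semigroup_generated A"
  using assms unfolding semigroup_generated_def by blast

lemma semigroup_generated_zero: "0 \<in> semigroup_generated A"
  using semigroup_generatedI[of "{}" A] by simp

lemma semigroup_generated_generator:
  assumes "a \<in> A"
  shows "a \<in> semigroup_generated A"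
  using semigroup_generatedI[of "{a}" A "\<lambda>_. 1"] assms by simp

lemma semigroup_generated_add:
  assumes "s \<in> semigroup_generated A" "t \<in> semigroup_generated A"
  shows "s + t \<in> semigroup_generated A"
proof -
  obtain B b where B: "finite B" "B \<subseteq> A" "s = (\<Sum>a\<in>B. b a * a)"
    using assms(1) unfolding semigroup_generated_def by blast
  obtain C c where C: "finite C" "C \<subseteq> A" "t = (\<Sum>a\<in>C. c a * a)"
    using assms(2) unfolding semigroup_generated_def by blast
  define e where "e a = (if a \<in> B then b a else 0) + (if a \<in> C then c a else 0)" for a
  have "(\<Sum>a\<in>B \<union> C. (if a \<in> B then b a else 0) * a) = s"
    unfolding B(3) by (rule sum.mono_neutral_cong_right) (use B C in auto)
  moreover have "(\<Sum>a\<in>B \<union> C. (if a \<in> C then c a else 0) * a) = t"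
    unfolding C(3) by (rule sum.mono_neutral_cong_right) (use B C in auto)
  ultimately have "(\<Sum>a\<in>B \<union> C. e a * a) = s + t"
    by (simp add: e_def add_mult_distrib sum.distrib)
  then show ?thesis
    using semigroup_generatedI[of "B \<union> C" A e] B C by simp
qed

lemma semigroup_generated_mult:
  assumes "s \<in> semigroup_generated A"
  shows "m * s \<in> semigroup_generated A"
  using assms by (induction m) (auto intro: semigroup_generated_zero semigroup_generated_add)

text \<open>Peeling off one generator at a time lets later proofs carry an invariant along a sum
  without handling coefficient functions.\<close>

lemma semigroup_generated_induct [consumes 1, case_names zero add]:
  assumes "s \<in> semigroup_generated A"
    and zero: "P 0"
    and add: "\<And>a s. a \<in> A \<Longrightarrow> s \<in> semigroup_generated A \<Longrightarrow> P s \<Longrightarrow> P (a + s)"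
  shows "P s"
proof -
  obtain B c where B: "finite B" "B \<subseteq> A" "s = (\<Sum>a\<in>B. c a * a)"
    using assms(1) unfolding semigroup_generated_def by blast
  have "P (\<Sum>a\<in>B. c a * a)"
    using B(1,2)
  proof (induction B rule: finite_induct)
    case empty
    then show ?case using zero by simp
  next
    case (insert a B)
    define r where "r = (\<Sum>a\<in>B. c a * a)"
    have r: "r \<in> semigroup_generated A" "P r" "a \<in> A"
      using insert semigroup_generatedI[of B A] by (auto simp: r_def)
    have "P (m * a + r)" for m
    proof (induction m)
      case (Suc m)
      have "m * a + r \<in> semigroup_generated A"
        by (intro semigroup_generated_add semigroup_generated_mult semigroup_generated_generator r)
      from add[OF \<open>a \<in> A\<close> this Suc] show ?case by (simp add: algebra_simps)
    qed (use r in simp)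
    then show ?case using insert by (simp add: r_def)
  qed
  then show ?thesis using B by simp
qed

lemma minimal_generators_iff:
  "s \<in> minimal_generators S \<longleftrightarrow>
    s \<in> S \<and> s > 0 \<and> (\<forall>u v. u \<in> S \<longrightarrow> v \<in> S \<longrightarrow> u > 0 \<longrightarrow> v > 0 \<longrightarrow> s \<noteq> u + v)"
  unfolding minimal_generators_def Let_def set_plus_def by auto

lemma not_minimal_generator_add:
  assumes "u \<in> S" "v \<in> S" "u > 0" "v > 0"
  shows "u + v \<notin> minimal_generators S"
  using assms by (auto simp: minimal_generators_iff)

lemma minimal_generators_subset:
  "minimal_generators (semigroup_generated A) \<subseteq> A"
proof
  fix s assume s: "s \<in> minimal_generators (semigroup_generated A)"
  then have "s \<in> semigroup_generated A" by (simp add: minimal_generators_iff)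
  from this s show "s \<in> A"
  proof (induction rule: semigroup_generated_induct)
    case (add a s)
    then have "a = 0 \<or> s = 0"
      using not_minimal_generator_add semigroup_generated_generator by blast
    then show ?case using add by auto
  qed (simp add: minimal_generators_iff)
qed

text \<open>Splitting off one copy of \<open>u\<close> or of \<open>v\<close> leaves a remainder in
  the semigroup, and the strict bounds make that remainder nonzero.\<close>

lemma not_minimal_generator_combination:
  assumes u: "u \<in> semigroup_generated A" "u < \<alpha> * u + \<beta> * v"
    and v: "v \<in> semigroup_generated A" "v < \<alpha> * u + \<beta> * v"
  shows "\<alpha> * u + \<beta> * v \<notin> minimal_generators (semigroup_generated A)"
proof -
  have mem: "i * u + j * v \<in> semigroup_generated A" for i j
    using u v semigroup_generated_add semigroup_generated_mult by simp
  consider i where "\<alpha> = Suc i" "u > 0" | j where "\<beta> = Suc j" "v > 0"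
    using u(2) by (cases \<alpha>; cases \<beta>; cases "u = 0"; cases "v = 0") auto
  then show ?thesis
  proof cases
    case 1
    then show ?thesis
      using not_minimal_generator_add[OF u(1) mem[of i \<beta>]] u(2) by (simp add: algebra_simps)
  next
    case 2
    then show ?thesis
      using not_minimal_generator_add[OF v(1) mem[of \<alpha> j]] v(2) by (simp add: algebra_simps)
  qed
qed

section \<open>Sequences with \<open>y (k + 2) + y k = L * y (k + 1)\<close>\<close>

lemma recurrence_strict_mono:
  fixes y :: "nat \<Rightarrow> nat"
  assumes "L \<ge> 2" "y 0 < y 1" and rec: "\<And>k. y (Suc (Suc k)) + y k = L * y (Suc k)"
  shows "strict_mono y"
proof (rule strict_mono_Suc_iff[THEN iffD2], rule allI)
  fix k show "y k < y (Suc k)"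
  proof (induction k)
    case (Suc k)
    have "2 * y (Suc k) \<le> L * y (Suc k)" using \<open>L \<ge> 2\<close> by simp
    then show ?case using Suc rec[of k] by linarith
  qed (use assms in simp)
qed

text \<open>For fixed \<open>i\<close>, the terms in \<open>m\<close> all obey the same linear
  recurrence, so agreement at \<open>m = 0\<close> and \<open>m = 1\<close> suffices. The integers
  serve to solve the recurrence for its last term.\<close>

lemma recurrence_add:
  fixes f y :: "nat \<Rightarrow> nat"
  assumes "f 0 = 0" "f 1 = 1" and f: "\<And>k. f (Suc (Suc k)) + f k = L * f (Suc k)"
    and y: "\<And>k. y (Suc (Suc k)) + y k = L * y (Suc k)"
  shows "y (Suc (i + m)) + f m * y i = f (Suc m) * y (Suc i)"
proof -
  have "int (y (Suc (i + m))) + int (f m) * int (y i) = int (f (Suc m)) * int (y (Suc i))"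
  proof (induction m rule: induct_nat_012)
    case 0
    then show ?case using assms by simp
  next
    case 1
    have "f (Suc (Suc 0)) = L" using f[of 0] assms by simp
    then show ?case using y[of i] assms by (simp flip: of_nat_mult of_nat_add)
  next
    case (ge2 m)
    have y2: "int (y (Suc (i + Suc (Suc m)))) = int L * int (y (Suc (i + Suc m))) - int (y (Suc (i + m)))"
      using y[of "Suc (i + m)"] by (simp flip: of_nat_mult of_nat_add add: algebra_simps)
    have f2: "int (f (Suc (Suc k))) = int L * int (f (Suc k)) - int (f k)" for k
      using f[of k] by (simp flip: of_nat_mult of_nat_add add: algebra_simps)
    show ?case using ge2 unfolding y2 f2[of m] f2[of "Suc m"] by algebra
  qed
  then show ?thesis by (simp flip: of_nat_mult of_nat_add)
qed

text \<open>The determinant \<open>y i * f (i + 1) - y (i + 1) * f i\<close> does not depend on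
  \<open>i\<close>, and at \<open>i = 0\<close> it is \<open>y 0\<close>.\<close>

lemma recurrence_cassini:
  fixes f y :: "nat \<Rightarrow> nat"
  assumes "f 0 = 0" "f 1 = 1" and f: "\<And>k. f (Suc (Suc k)) + f k = L * f (Suc k)"
    and y: "\<And>k. y (Suc (Suc k)) + y k = L * y (Suc k)"
  shows "y i * f (Suc i) = y (Suc i) * f i + y 0"
proof (induction i)
  case (Suc i)
  have "y (Suc i) * (f (Suc (Suc i)) + f i) = f (Suc i) * (y (Suc (Suc i)) + y i)"
    unfolding f y by simp
  with Suc show ?case by (simp add: algebra_simps)
qed (use assms in simp)

text \<open>Expanding \<open>y k\<close> and \<open>f k\<close> around index \<open>i\<close>
  reduces the difference of the two sides to the determinant above: it equals
  \<open>f (k - i) * y 0\<close>, which is positive.\<close>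

lemma recurrence_ratio_less:
  fixes f y :: "nat \<Rightarrow> nat"
  assumes f01: "f 0 = 0" "f 1 = 1" and f: "\<And>k. f (Suc (Suc k)) + f k = L * f (Suc k)"
    and y: "\<And>k. y (Suc (Suc k)) + y k = L * y (Suc k)"
    and "L \<ge> 2" "y 0 > 0" "i < k"
  shows "y k * f i < y i * f k"
proof -
  obtain m where k: "k = Suc (i + m)" using \<open>i < k\<close> less_iff_Suc_add by blast
  have "strict_mono f" using recurrence_strict_mono[of L f] assms by simp
  then have "f (Suc m) > 0" using f01 by (metis strict_monoD zero_less_Suc)
  moreover have "int (y i) * int (f k) = int (y k) * int (f i) + int (f (Suc m)) * int (y 0)"
  proof -
    have "int (y k) + int (f m) * int (y i) = int (f (Suc m)) * int (y (Suc i))"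
      using recurrence_add[of f L y i m] assms k by (simp flip: of_nat_mult of_nat_add)
    moreover have "int (f k) + int (f m) * int (f i) = int (f (Suc m)) * int (f (Suc i))"
      using recurrence_add[of f L f i m] assms k by (simp flip: of_nat_mult of_nat_add)
    moreover have "int (y i) * int (f (Suc i)) = int (y (Suc i)) * int (f i) + int (y 0)"
      using recurrence_cassini[of f L y i] assms by (simp flip: of_nat_mult of_nat_add)
    ultimately show ?thesis by algebra
  qed
  then have "y i * f k = y k * f i + f (Suc m) * y 0"
    by (simp flip: of_nat_mult of_nat_add)
  ultimately show ?thesis using \<open>y 0 > 0\<close> by simp
qed

section \<open>Which \<open>x k\<close> are minimal generators\<close>

lemma recurrence_decomposable:
  fixes f x :: "nat \<Rightarrow> nat"
  assumes f01: "f 0 = 0" "f 1 = 1" and f: "\<And>k. f (Suc (Suc k)) + f k = L * f (Suc k)"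
    and x: "\<And>k. x (Suc (Suc k)) + x k = L * x (Suc k)"
    and "L \<ge> 2" "x 0 > 0" "x 0 < x 1" and k: "x 0 \<le> f k"
  shows "x k \<notin> minimal_generators (semigroup_generated (range x))"
proof -
  let ?S = "semigroup_generated (range x)"
  have mono: "strict_mono x" using recurrence_strict_mono[of L x] assms by simp
  then have pos: "x i > 0" for i using \<open>x 0 > 0\<close> by (metis strict_mono_less_eq le0 less_le_trans)
  have mem: "x i \<in> ?S" for i by (simp add: semigroup_generated_generator)
  have "k > 0" using assms by (cases k) auto
  \<comment> \<open>The first crossing of the decreasing \<open>f (k - j)\<close> and the increasing
    \<open>x j\<close>. Its predecessor \<open>i\<close> fails the inequality, so both coefficients
    \<open>x (i + 1) - f (k - i - 1)\<close> and \<open>f (k - i) - x i\<close> are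
    nonnegative.\<close>
  define j where "j = (LEAST j. f (k - j) < x j)"
  have "f (k - k) < x k" using f01 pos by simp
  then have j: "f (k - j) < x j" "j \<le> k"
    unfolding j_def by (rule LeastI, rule Least_le)
  have "j \<noteq> 0" using j(1) k by (intro notI) simp
  then obtain i where i: "j = Suc i" by (cases j) auto
  have xi: "x i \<le> f (k - i)"
    using not_less_Least[of i "\<lambda>j. f (k - j) < x j"] i unfolding j_def by simp
  define m where "m = k - Suc i"
  have m: "k = Suc (i + m)" "k - i = Suc m" "k - j = m" using j(2) i by (auto simp: m_def)
  have eq: "x k + f m * x i = f (Suc m) * x (Suc i)"
    using recurrence_add[of f L x i m] assms m by simp
  show ?thesis
  proof (cases m)
    \<comment> \<open>Here \<open>x (i + 1)\<close> is \<open>x k\<close> itself, so the general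
      combination gives nothing; but \<open>x i \<le> f 1 = 1\<close>, and \<open>x k\<close> copies
      of \<open>x i = 1\<close> do.\<close>
    case 0
    then have "x i = 1" using xi pos[of i] f01 m by simp
    moreover have "x i < x k" using mono m by (simp add: strict_monoD)
    ultimately show ?thesis
      using not_minimal_generator_combination[of "x i" "range x" "x k" 0 "x i"] mem[of i] by simp
  next
    case (Suc m')
    have less: "x i < x k" "x (Suc i) < x k" using mono m Suc by (simp_all add: strict_monoD)
    have "int (x k) = int (x (Suc i) - f m) * int (x i) + int (f (Suc m) - x i) * int (x (Suc i))"
    proof -
      have "int (x (Suc i) - f m) = int (x (Suc i)) - int (f m)"
        "int (f (Suc m) - x i) = int (f (Suc m)) - int (x i)"
        using j(1) xi m i by (simp_all add: of_nat_diff)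
      moreover have "int (x k) + int (f m) * int (x i) = int (f (Suc m)) * int (x (Suc i))"
        using eq by (simp flip: of_nat_mult of_nat_add)
      ultimately show ?thesis by algebra
    qed
    then have "x k = (x (Suc i) - f m) * x i + (f (Suc m) - x i) * x (Suc i)"
      by (simp flip: of_nat_mult of_nat_add)
    then show ?thesis
      using not_minimal_generator_combination less mem by metis
  qed
qed

lemma recurrence_indecomposable:
  fixes f x :: "nat \<Rightarrow> nat"
  assumes f01: "f 0 = 0" "f 1 = 1" and f: "\<And>k. f (Suc (Suc k)) + f k = L * f (Suc k)"
    and x: "\<And>k. x (Suc (Suc k)) + x k = L * x (Suc k)"
    and "L \<ge> 2" "x 0 > 0" "x 0 < x 1" "coprime (x 0) (x 1)" and k: "f k < x 0"
  shows "x k \<in> minimal_generators (semigroup_generated (range x))"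
proof -
  let ?S = "semigroup_generated (range x)"
  have mono: "strict_mono x" using recurrence_strict_mono[of L x] assms by simp
  then have pos: "x i > 0" for i using \<open>x 0 > 0\<close> by (metis strict_mono_less_eq le0 less_le_trans)
  have x_cong: "[x i = x 1 * f i] (mod x 0)" for i
  proof (cases i)
    case 0
    then show ?thesis using f01 by (simp add: cong_def)
  next
    case (Suc m)
    have "x (Suc m) + f m * x 0 = f (Suc m) * x 1"
      using recurrence_add[of f L x 0 m] assms by simp
    then show ?thesis using Suc by (metis cong_def mod_mult_self1 mult.commute)
  qed
  \<comment> \<open>\<open>N\<close> collects \<open>f i\<close> over the generators
    \<open>x i\<close> summed to \<open>s\<close>; the bound on \<open>s\<close> forces each
    \<open>i < k\<close>, where the ratio inequality applies. The empty sum is separate because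
    strictness fails there.\<close>
  have N: "\<exists>N. [s = x 1 * N] (mod x 0) \<and> (if s = 0 then N = 0 else x k * N < s * f k)"
    if "s \<in> ?S" "s < x k" for s
    using that
  proof (induction rule: semigroup_generated_induct)
    case zero
    then show ?case by simp
  next
    case (add a s)
    then obtain i where i: "a = x i" by auto
    from add obtain N where N: "[s = x 1 * N] (mod x 0)" "if s = 0 then N = 0 else x k * N < s * f k"
      by auto
    have "i < k" using add i strict_mono_less[OF mono, of i k] by simp
    then have "x k * f i < x i * f k" using recurrence_ratio_less[of f L x i k] assms by simp
    then have "x k * (f i + N) < (a + s) * f k"
      using N(2) i by (auto simp: algebra_simps split: if_splits)
    moreover have "[a + s = x 1 * (f i + N)] (mod x 0)"
      using cong_add[OF x_cong[of i] N(1)] i by (simp add: algebra_simps)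
    ultimately show ?case using pos i by (intro exI[of _ "f i + N"]) auto
  qed
  have "x k \<noteq> u + v" if uv: "u \<in> ?S" "v \<in> ?S" "u > 0" "v > 0" for u v
  proof
    assume eq: "x k = u + v"
    obtain M where M: "[u = x 1 * M] (mod x 0)" "x k * M < u * f k"
      using N[of u] uv eq by auto
    obtain N where N: "[v = x 1 * N] (mod x 0)" "x k * N < v * f k"
      using N[of v] uv eq by auto
    have "x k * (M + N) < x k * f k" using M(2) N(2) eq by (simp add: algebra_simps)
    then have less: "M + N < f k" by simp
    have "[x k = x 1 * (M + N)] (mod x 0)"
      using cong_add[OF M(1) N(1)] eq by (simp add: algebra_simps)
    then have "[x 1 * (M + N) = x 1 * f k] (mod x 0)"
      using x_cong[of k] by (metis cong_sym cong_trans)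
    then have "[M + N = f k] (mod x 0)"
      using \<open>coprime (x 0) (x 1)\<close> by (simp add: cong_mult_lcancel_nat coprime_commute)
    \<comment> \<open>Both numbers lie below \<open>x 0\<close>, so congruence would make them
      equal.\<close>
    then show False using less k by (simp add: cong_def)
  qed
  then show ?thesis using pos by (simp add: minimal_generators_iff semigroup_generated_generator)
qed

text \<open>As \<open>f\<close> increases, the two criteria split the indices at
  \<open>\<kappa>\<close>: the minimal generators are exactly \<open>x 0\<close>, ...,
  \<open>x (\<kappa> - 1)\<close>, distinct because \<open>x\<close> increases.\<close>

theorem embedding_dimension_recurrence:
  fixes f x :: "nat \<Rightarrow> nat"
  assumes f01: "f 0 = 0" "f 1 = 1" and f: "\<And>k. f (Suc (Suc k)) + f k = L * f (Suc k)"
    and x: "\<And>k. x (Suc (Suc k)) + x k = L * x (Suc k)"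
    and "L \<ge> 2" "x 0 > 0" "x 0 < x 1" "coprime (x 0) (x 1)"
  shows "embedding_dimension (semigroup_generated (range x)) = (LEAST \<kappa>. \<kappa> \<ge> 1 \<and> f \<kappa> \<ge> x 0)"
proof -
  let ?M = "minimal_generators (semigroup_generated (range x))"
  define \<kappa> where "\<kappa> = (LEAST \<kappa>. \<kappa> \<ge> 1 \<and> f \<kappa> \<ge> x 0)"
  have mono_f: "strict_mono f" using recurrence_strict_mono[of L f] assms by simp
  have mono_x: "strict_mono x" using recurrence_strict_mono[of L x] assms by simp
  \<comment> \<open>A witness that the minimum exists: a strictly increasing \<open>f\<close>
    satisfies \<open>f m \<ge> m\<close>.\<close>
  have "x 0 \<ge> 1 \<and> f (x 0) \<ge> x 0"
    using \<open>x 0 > 0\<close> strict_mono_imp_increasing[OF mono_f] by simp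
  then have \<kappa>: "\<kappa> \<ge> 1 \<and> f \<kappa> \<ge> x 0" unfolding \<kappa>_def by (rule LeastI)
  have *: "f k < x 0 \<longleftrightarrow> k < \<kappa>" for k
  proof
    assume "f k < x 0"
    then have "f k < f \<kappa>" using \<kappa> by simp
    then show "k < \<kappa>" using strict_mono_less[OF mono_f] by simp
  next
    assume "k < \<kappa>"
    then have "\<not> (k \<ge> 1 \<and> f k \<ge> x 0)" unfolding \<kappa>_def by (rule not_less_Least)
    then show "f k < x 0" using f01 \<open>x 0 > 0\<close> by (cases k) auto
  qed
  have iff: "x k \<in> ?M \<longleftrightarrow> k < \<kappa>" for k
    using recurrence_decomposable[of f L x k] recurrence_indecomposable[of f L x k] assms *[of k]
    by (metis not_less)
  then have "?M = x ` {..<\<kappa>}"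
    using minimal_generators_subset[of "range x"] by auto
  then have "card ?M = \<kappa>"
    using strict_mono_imp_inj_on[OF mono_x] by (simp add: card_image inj_on_subset)
  then show ?thesis by (simp add: embedding_dimension_def \<kappa>_def)
qed

section \<open>Fibonacci-type sequences sampled at an even step\<close>

lemma fib_recurrence_add:
  fixes g :: "nat \<Rightarrow> nat"
  assumes g: "\<And>k. g (Suc (Suc k)) = g (Suc k) + g k"
  shows "g (Suc (j + m)) = fib m * g j + fib (Suc m) * g (Suc j)"
  by (induction m rule: induct_nat_012) (simp_all add: g algebra_simps)

text \<open>Cayley-Hamilton for the matrix advancing \<open>(g i, g (i + 1))\<close> by
  \<open>e + 1\<close> places: its trace is \<open>fib e + fib (e + 2)\<close>, and by Cassini its
  determinant is 1 because \<open>e\<close> is odd.\<close>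

lemma fib_recurrence_step:
  fixes g :: "nat \<Rightarrow> nat"
  assumes g: "\<And>k. g (Suc (Suc k)) = g (Suc k) + g k" and d: "even (Suc e)"
  shows "g (j + Suc e + Suc e) + g j = (fib e + fib (Suc (Suc e))) * g (j + Suc e)"
proof -
  have c: "int (fib e) * int (fib (Suc (Suc e))) = int (fib (Suc e)) ^ 2 + 1"
    using fib_Cassini_int[of e] d by (simp add: algebra_simps power2_eq_square del: fib.simps(3))
  have a: "int (g (i + Suc e)) = int (fib e) * int (g i) + int (fib (Suc e)) * int (g (Suc i))" for i
    using fib_recurrence_add[of g i e, OF g] by (simp flip: of_nat_mult of_nat_add)
  have b: "int (g (Suc (j + Suc e)))
      = int (fib (Suc e)) * int (g j) + int (fib (Suc (Suc e))) * int (g (Suc j))"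
    using fib_recurrence_add[of g j "Suc e", OF g]
    by (simp flip: of_nat_mult of_nat_add del: fib.simps(3))
  have "int (g (j + Suc e + Suc e)) + int (g j)
      = (int (fib e) + int (fib (Suc (Suc e)))) * int (g (j + Suc e))"
    using c a[of j] a[of "j + Suc e"] b by algebra
  then show ?thesis by (simp flip: of_nat_mult of_nat_add del: fib.simps(3))
qed

theorem theorem3p1p1:
  fixes V :: "nat \<Rightarrow> nat" and n d :: nat and S :: "nat set"
  assumes V_pos: "\<And>j. j \<ge> 1 \<Longrightarrow> V j > 0"
    and V_rec: "\<And>j. j \<ge> 3 \<Longrightarrow> V j = V (j - 1) + V (j - 2)"
    and n: "n \<ge> 1"
    and d: "d \<ge> 2" "even d"
    and coprime_start: "gcd (V 1) (V 2) = 1"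
    and coprime_fib: "gcd (V n) (fib d) = 1"
    and S: "S = semigroup_generated {V (n + k * d) | k. True}"
  shows "embedding_dimension S =
    (LEAST \<kappa>. \<kappa> \<ge> 1 \<and> real (fib (\<kappa> * d)) / real (fib d) \<ge> real (V n))"
proof -
  define x where "x k = V (n + k * d)" for k
  \<comment> \<open>The division is exact, since \<open>fib d\<close> divides
    \<open>fib (k * d)\<close>; hence \<open>f k\<close> agrees with the real quotient in the
    conclusion.\<close>
  define f where "f k = fib (k * d) div fib d" for k
  obtain e where e: "d = Suc e" "e \<ge> 1" using d by (cases d) auto
  define L where "L = fib e + fib (Suc (Suc e))"
  have fib_pos: "fib d > 0" using d by (simp add: fib_neq_0_nat)
  have "fib d dvd fib (k * d)" for k
    using fib_gcd[of d "k * d"] by (metis gcd_nat.absorb1 dvd_triv_right gcd_dvd2)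
  then have f_mult: "fib d * f k = fib (k * d)" for k by (simp add: f_def)
  have g: "V (n + Suc (Suc k)) = V (n + Suc k) + V (n + k)" for k
    using V_rec[of "n + Suc (Suc k)"] n by simp
  have "coprime (V (Suc k)) (V (Suc (Suc k)))" for k
  proof (induction k)
    case 0
    then show ?case using coprime_start by (simp add: coprime_iff_gcd_eq_1 numeral_2_eq_2)
  next
    case (Suc k)
    then show ?case using V_rec[of "Suc (Suc (Suc k))"]
      by (simp add: coprime_iff_gcd_eq_1 gcd.commute)
  qed
  from this[of "n - 1"] have cop: "coprime (V n) (V (Suc n))" using n by simp
  \<comment> \<open>Modulo \<open>V n\<close> only \<open>fib d * V (n + 1)\<close> remains, and
    both factors are coprime to \<open>V n\<close>. The same formula yields
    \<open>x 0 < x 1\<close>, as \<open>e \<ge> 1\<close> gives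
    \<open>fib e \<ge> 1\<close>.\<close>
  have x1: "x 1 = fib e * V n + fib d * V (Suc n)"
    using fib_recurrence_add[of "\<lambda>k. V (n + k)" 0 e, OF g] e by (simp add: x_def)
  have "coprime (V n) (fib d * V (Suc n))"
    using cop coprime_fib by (metis coprime_iff_gcd_eq_1 coprime_mult_right_iff)
  then have "coprime (x 0) (x 1)"
    unfolding x1 by (simp add: x_def coprime_iff_gcd_eq_1 gcd_add_mult add.commute)
  moreover have "x 0 < x 1"
  proof -
    have "fib e \<ge> 1" using e by (simp add: Suc_le_eq fib_neq_0_nat)
    then have "V n \<le> fib e * V n" by simp
    moreover have "fib d * V (Suc n) > 0" using fib_pos V_pos by simp
    ultimately have "V n < fib e * V n + fib d * V (Suc n)" by linarith
    then show ?thesis unfolding x1 by (simp add: x_def)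
  qed
  moreover have "x 0 > 0" using V_pos n by (simp add: x_def)
  moreover have "L \<ge> 2"
  proof -
    have "fib e \<ge> 1" "fib (Suc e) \<ge> 1" using e by (simp_all add: Suc_le_eq fib_neq_0_nat)
    then show ?thesis by (simp add: L_def)
  qed
  moreover have "x (Suc (Suc k)) + x k = L * x (Suc k)" for k
    using fib_recurrence_step[of "\<lambda>k. V (n + k)" e "k * d", OF g] d e
    by (simp add: x_def L_def algebra_simps del: fib.simps(3))
  moreover have "f (Suc (Suc k)) + f k = L * f (Suc k)" for k
  proof -
    have "fib (Suc (Suc k) * d) + fib (k * d) = L * fib (Suc k * d)"
      using fib_recurrence_step[of fib e "k * d"] d e
      by (simp add: L_def algebra_simps)
    \<comment> \<open>The recurrence for \<open>fib (k * d)\<close> passes to \<open>f\<close> by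
      cancelling the positive factor \<open>fib d\<close>.\<close>
    then have "fib d * (f (Suc (Suc k)) + f k) = fib d * (L * f (Suc k))"
      by (simp only: f_mult distrib_left mult.left_commute)
    then show ?thesis using fib_pos by simp
  qed
  moreover have "f 0 = 0" "f 1 = 1" using fib_pos by (simp_all add: f_def)
  ultimately have "embedding_dimension (semigroup_generated (range x))
      = (LEAST \<kappa>. \<kappa> \<ge> 1 \<and> f \<kappa> \<ge> x 0)"
    by (intro embedding_dimension_recurrence[of f L x])
  moreover have "range x = {V (n + k * d) | k. True}" by (auto simp: x_def)
  moreover have "real (fib (k * d)) / real (fib d) = real (f k)" for k
    using f_mult[of k] fib_pos by (simp add: field_simps flip: of_nat_mult)
  ultimately show ?thesis by (simp add: S x_def)
qed

end
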